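(* Let $\mathbb{X}=(X_n,n\ge 1)$ be a strictly stationary sequence of real random variables on a probability space $(\Omega,\mathcal{F},\mathbb{P})$, let $\lambda\in(0,1)$, and let $\mathbb{Q}$ be the stationary probability measure on $(\mathbb{R}^{\mathbb{N}},\mathcal{B}(\mathbb{R}^{\mathbb{N}}))$ defined by $\mathbb{Q}(B)=\mathbb{P}(\mathbb{X}\in B)$ for all $B\in\mathcal{B}(\mathbb{R}^{\mathbb{N}})$. On $(\mathbb{R}^{\mathbb{N}},\mathcal{B}(\mathbb{R}^{\mathbb{N}}),\mathbb{Q})$ define the random variable $Y\colon\mathbb{R}^{\mathbb{N}}\to\mathbb{R}$ by $Y((x_1,x_2,\ldots))=x_1$ for $(x_1,x_2,\ldots)\in\mathbb{R}^{\mathbb{N}}$. If the conditional $\lambda$th quantile $\pi_{\lambda}(X_1|\mathcal{I}^{\mathbb{X}})$ of $X_1$ given $\mathcal{I}^{\mathbb{X}}$ is unique, then the conditional $\lambda$th quantile $\pi_{\lambda}(Y|\tilde{\mathcal{I}})$ of $Y$ given $\tilde{\mathcal{I}}$ is also unique.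
   Context: $\mathbb{R}^{\mathbb{N}}$ is the set of real sequences $(x_1,x_2,\ldots)$ and $\mathcal{B}(\mathbb{R}^{\mathbb{N}})$ its Borel sigma-field. Let $T\colon\mathbb{R}^{\mathbb{N}}\to\mathbb{R}^{\mathbb{N}}$ be the shift $T((x_1,x_2,\ldots))=(x_2,x_3,\ldots)$. A probability measure $\mathbb{Q}$ on $(\mathbb{R}^{\mathbb{N}},\mathcal{B}(\mathbb{R}^{\mathbb{N}}))$ is stationary if $\mathbb{Q}(T^{-1}B)=\mathbb{Q}(B)$ for all $B\in\mathcal{B}(\mathbb{R}^{\mathbb{N}})$. A set $B\in\mathcal{B}(\mathbb{R}^{\mathbb{N}})$ is invariant if $B=T^{-1}B$; $\tilde{\mathcal{I}}$ denotes the class of all invariant sets, which is a sigma-field. A set $A\in\mathcal{F}$ is called invariant with respect to $\mathbb{X}=(X_n,n\ge1)$ if there exists $B\in\mathcal{B}(\mathbb{R}^{\mathbb{N}})$ such that $A=\{\omega\in\Omega: (X_i(\omega),X_{i+1}(\omega),\ldots)\in B\}$ for every $i\ge 1$. $\mathcal{I}^{\mathbb{X}}$ denotes the collection of all such sets; it is a sigma-field. Conditional quantile: let $X$ be a real random variable on a probability space $(\Omega,\mathcal{F},\mathbb{P})$, $\mathcal{G}\subseteq\mathcal{F}$ a sigma-field and $\lambda\in(0,1)$. A random variable $Q_\lambda$ is called (a version of) a conditional $\lambda$th quantile of $X$ with respect to $\mathcal{G}$, denoted $\pi_\lambda(X|\mathcal{G})$, if (i) $Q_\lambda$ is $\mathcal{G}$-measurable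 and (ii) $\mathbb{P}(X\ge Q_\lambda|\mathcal{G})\ge 1-\lambda$ and $\mathbb{P}(X\le Q_\lambda|\mathcal{G})\ge\lambda$ almost surely. At least one version always exists. $\pi_\lambda(X|\mathcal{G})$ is called unique if any two versions of it are almost surely equal. *)

theory Defs
  imports "HOL-Probability.Probability"
begin

text \<open>
  Sequences are indexed from 0, so the sequence \<open>(X\<^sub>1, X\<^sub>2, \<dots>)\<close> is
  represented by \<open>X :: nat \<Rightarrow> 'a \<Rightarrow> real\<close> with \<open>X 0\<close> in the role of \<open>X\<^sub>1\<close>.
  The space of real sequences with its Borel sigma-field is
  \<open>borel :: (nat \<Rightarrow> real) measure\<close>, where \<open>nat \<Rightarrow> real\<close> carries the product topology.
\<close>

definition strictly_stationary :: "'a measure \<Rightarrow> (nat \<Rightarrow> 'a \<Rightarrow> real) \<Rightarrow> bool" where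
  "strictly_stationary M X \<longleftrightarrow>
     (\<forall>J h. finite J \<longrightarrow>
        distr M (\<Pi>\<^sub>M j\<in>J. borel) (\<lambda>\<omega>. \<lambda>j\<in>J. X (j + h) \<omega>) =
        distr M (\<Pi>\<^sub>M j\<in>J. borel) (\<lambda>\<omega>. \<lambda>j\<in>J. X j \<omega>))"

definition seq_shift :: "(nat \<Rightarrow> real) \<Rightarrow> (nat \<Rightarrow> real)" where
  "seq_shift x = (\<lambda>n. x (Suc n))"

definition stationary_measure :: "(nat \<Rightarrow> real) measure \<Rightarrow> bool" where
  "stationary_measure Q \<longleftrightarrow>
     prob_space Q \<and> sets Q = sets borel \<and>
     (\<forall>B\<in>sets borel. measure Q (seq_shift -` B) = measure Q B)"

definition shift_invariant_sets :: "(nat \<Rightarrow> real) set set" where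
  "shift_invariant_sets = {B \<in> sets borel. B = seq_shift -` B}"

definition invariant_events :: "'a measure \<Rightarrow> (nat \<Rightarrow> 'a \<Rightarrow> real) \<Rightarrow> 'a set set" where
  "invariant_events M X =
     {A \<in> sets M. \<exists>B\<in>sets borel. \<forall>i. A = {\<omega> \<in> space M. (\<lambda>n. X (i + n) \<omega>) \<in> B}}"

text \<open>
  The library's conditional expectation expects a sub-sigma-field as a measure of which only
  the space and the sets matter. Both classes above are already sigma-fields, so
  \<open>sigma\<close> adds no sets (lemmas \<open>sets_shift_invariant_field\<close> and \<open>sets_invariant_field\<close>).
\<close>

definition shift_invariant_field :: "(nat \<Rightarrow> real) measure" where
  "shift_invariant_field = sigma UNIV shift_invariant_sets"

definition invariant_field :: "'a measure \<Rightarrow> (nat \<Rightarrow> 'a \<Rightarrow> real) \<Rightarrow> 'a measure" where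
  "invariant_field M X = sigma (space M) (invariant_events M X)"

definition conditional_prob :: "'a measure \<Rightarrow> 'a measure \<Rightarrow> 'a set \<Rightarrow> 'a \<Rightarrow> real" where
  "conditional_prob M G A = real_cond_exp M G (indicator A)"

definition is_cond_quantile ::
    "'a measure \<Rightarrow> 'a measure \<Rightarrow> ('a \<Rightarrow> real) \<Rightarrow> real \<Rightarrow> ('a \<Rightarrow> real) \<Rightarrow> bool" where
  "is_cond_quantile M G X l q \<longleftrightarrow>
     q \<in> borel_measurable G \<and>
     (AE \<omega> in M. conditional_prob M G {\<omega>' \<in> space M. X \<omega>' \<ge> q \<omega>'} \<omega> \<ge> 1 - l) \<and>
     (AE \<omega> in M. conditional_prob M G {\<omega>' \<in> space M. X \<omega>' \<le> q \<omega>'} \<omega> \<ge> l)"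

definition cond_quantile_unique ::
    "'a measure \<Rightarrow> 'a measure \<Rightarrow> ('a \<Rightarrow> real) \<Rightarrow> real \<Rightarrow> bool" where
  "cond_quantile_unique M G X l \<longleftrightarrow>
     (\<forall>q q'. is_cond_quantile M G X l q \<longrightarrow> is_cond_quantile M G X l q' \<longrightarrow>
        (AE \<omega> in M. q \<omega> = q' \<omega>))"

lemma measurable_seq_shift: "seq_shift \<in> borel_measurable borel"
  unfolding seq_shift_def by (rule measurable_coordinatewise_then_product) simp

lemma sets_shift_invariant_field: "sets shift_invariant_field = shift_invariant_sets"
proof -
  have "sigma_algebra UNIV shift_invariant_sets"
    unfolding sigma_algebra_iff2 shift_invariant_sets_def by (auto simp: Compl_eq_Diff_UNIV[symmetric])
  then show ?thesis
    unfolding shift_invariant_field_def by (rule sigma_algebra.sets_measure_of_eq)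
qed

lemma subalgebra_shift_invariant_field:
  assumes "sets Q = sets borel"
  shows "subalgebra Q shift_invariant_field"
  using assms sets_eq_imp_space_eq[OF assms]
  by (auto simp: subalgebra_def sets_shift_invariant_field)
     (auto simp: shift_invariant_sets_def shift_invariant_field_def)

lemma sets_invariant_field: "sets (invariant_field M X) = invariant_events M X"
proof -
  have "sigma_algebra (space M) (invariant_events M X)"
    unfolding sigma_algebra_iff2
  proof (intro conjI ballI allI impI)
    show "invariant_events M X \<subseteq> Pow (space M)"
      unfolding invariant_events_def using sets.sets_into_space by auto
    show "{} \<in> invariant_events M X"
      unfolding invariant_events_def by (auto intro!: bexI[of _ "{}"])
  next
    fix A assume "A \<in> invariant_events M X"
    then obtain B where "A \<in> sets M" "B \<in> sets borel"
      and A: "\<And>i. A = {\<omega> \<in> space M. (\<lambda>n. X (i + n) \<omega>) \<in> B}"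
      unfolding invariant_events_def by blast
    moreover have "space M - A = {\<omega> \<in> space M. (\<lambda>n. X (i + n) \<omega>) \<in> - B}" for i
      using A[of i] by auto
    moreover have "- B \<in> sets borel" using \<open>B \<in> sets borel\<close> by auto
    ultimately show "space M - A \<in> invariant_events M X"
      unfolding invariant_events_def by blast
  next
    fix A :: "nat \<Rightarrow> 'a set" assume "range A \<subseteq> invariant_events M X"
    then have "\<forall>k. \<exists>B. A k \<in> sets M \<and> B \<in> sets borel \<and>
        (\<forall>i. A k = {\<omega> \<in> space M. (\<lambda>n. X (i + n) \<omega>) \<in> B})"
      unfolding invariant_events_def by blast
    then obtain B where B: "\<And>k. A k \<in> sets M" "\<And>k. B k \<in> sets borel"
      and A: "\<And>k i. A k = {\<omega> \<in> space M. (\<lambda>n. X (i + n) \<omega>) \<in> B k}"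
      by metis
    have "(\<Union>k. A k) = {\<omega> \<in> space M. (\<lambda>n. X (i + n) \<omega>) \<in> (\<Union>k. B k)}" for i
      using A[of _ i] by auto
    moreover have "(\<Union>k. A k) \<in> sets M" "(\<Union>k. B k) \<in> sets borel"
      using B by auto
    ultimately show "(\<Union>k. A k) \<in> invariant_events M X"
      unfolding invariant_events_def by blast
  qed
  then show ?thesis
    unfolding invariant_field_def by (rule sigma_algebra.sets_measure_of_eq)
qed

lemma subalgebra_invariant_field: "subalgebra M (invariant_field M X)"
  by (auto simp: subalgebra_def sets_invariant_field)
     (auto simp: invariant_events_def invariant_field_def space_measure_of_conv)

lemma stationary_measure_law:
  assumes "prob_space M" "\<And>n. X n \<in> borel_measurable M" "strictly_stationary M X"
  shows "stationary_measure (distr M borel (\<lambda>\<omega> n. X n \<omega>))"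
proof -
  interpret prob_space M by fact
  have XP: "(\<lambda>\<omega> n. X (n + h) \<omega>) \<in> measurable M (\<Pi>\<^sub>M n\<in>UNIV. borel)" for h
    by (rule measurable_PiM_single') (use assms(2) in auto)
  have XB: "(\<lambda>\<omega> n. X n \<omega>) \<in> borel_measurable M"
    by (rule measurable_coordinatewise_then_product) (use assms(2) in auto)
  have sB: "sets (\<Pi>\<^sub>M n\<in>UNIV. borel :: real measure) = sets (borel :: (nat \<Rightarrow> real) measure)"
    by (rule sets_PiM_equal_borel)
  let ?D = "\<lambda>h. distr M (\<Pi>\<^sub>M n\<in>UNIV. borel) (\<lambda>\<omega> n. X (n + h) \<omega>)"
  have D: "?D h = ?D 0" for h
  proof (rule measure_eqI_PiM_infinite)
    fix A :: "nat \<Rightarrow> real set" and J :: "nat set"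
    assume J: "finite J" "J \<subseteq> UNIV" and A: "\<And>i. i \<in> J \<Longrightarrow> A i \<in> sets borel"
    let ?E = "prod_emb UNIV (\<lambda>_. borel) J (Pi\<^sub>E J A)"
    have E: "?E \<in> sets (\<Pi>\<^sub>M n\<in>UNIV. borel)" using J A by (intro sets_PiM_I) auto
    have m: "(\<lambda>\<omega>. \<lambda>j\<in>J. X (j + k) \<omega>) \<in> measurable M (\<Pi>\<^sub>M j\<in>J. borel)" for k
      by (rule measurable_restrict) (use assms(2) in auto)
    have PA: "Pi\<^sub>E J A \<in> sets (\<Pi>\<^sub>M j\<in>J. borel)" using J A by (intro sets_PiM_I_finite) auto
    have *: "emeasure (?D k) ?E =
        emeasure (distr M (\<Pi>\<^sub>M j\<in>J. borel) (\<lambda>\<omega>. \<lambda>j\<in>J. X (j + k) \<omega>)) (Pi\<^sub>E J A)" for k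
      unfolding emeasure_distr[OF XP E] emeasure_distr[OF m PA]
      by (rule arg_cong[where f = "emeasure M"])
         (auto simp: prod_emb_def restrict_def fun_eq_iff)
    show "emeasure (?D h) ?E = emeasure (?D 0) ?E"
      unfolding * using assms(3) J by (simp add: strictly_stationary_def)
  qed (auto intro!: prob_space.finite_measure prob_space_distr XP)
  have "measure (distr M borel (\<lambda>\<omega> n. X n \<omega>)) (seq_shift -` B) =
        measure (distr M borel (\<lambda>\<omega> n. X n \<omega>)) B" if B: "B \<in> sets borel" for B
  proof -
    have B': "seq_shift -` B \<in> sets borel"
      using measurable_sets[OF measurable_seq_shift B] by simp
    have BP: "B \<in> sets (\<Pi>\<^sub>M n\<in>UNIV. borel)" using B sB by simp
    have "measure (?D 1) B = measure (?D 0) B" by (simp only: D[of 1])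
    then have "measure M ((\<lambda>\<omega> n. X (n + 1) \<omega>) -` B \<inter> space M) =
        measure M ((\<lambda>\<omega> n. X (n + 0) \<omega>) -` B \<inter> space M)"
      unfolding measure_distr[OF XP BP] .
    then show ?thesis
      unfolding measure_distr[OF XB B] measure_distr[OF XB B']
      by (simp add: vimage_def seq_shift_def)
  qed
  then show ?thesis
    unfolding stationary_measure_def by (auto intro: prob_space_distr XB)
qed

end

theory Submission
  imports Defs
begin

text \<open>
  The law map \<open>\<Phi> \<omega> = (X n \<omega>)\<^sub>n\<close> pulls the shift-invariant sets back exactly onto the events
  invariant with respect to \<open>X\<close>: if \<open>A\<close> is the preimage of \<open>B\<close> under every shifted process, then
  it is also the preimage of the shift-invariant set \<open>{x. T^i x \<in> B for infinitely many i}\<close>.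
  Conditional probabilities under the law of \<open>X\<close> therefore pull back along \<open>\<Phi>\<close>, so that every
  version \<open>q\<close> of the quantile of the first coordinate yields a version \<open>q \<circ> \<Phi>\<close> of the quantile
  of \<open>X 0\<close>, and almost sure equality is transported back along \<open>\<Phi>\<close>.
\<close>

text \<open>By \<open>fGH\<close>, composing with \<open>f\<close> gives a
  \<open>G\<close>-measurable candidate. By \<open>pull\<close>, each test set of \<open>G\<close>
  is a preimage of some \<open>C\<close> in \<open>H\<close>, so a change of variables reduces the
  averaging identity on \<open>M\<close> to the one defining the conditional probability under the
  law of \<open>f\<close>.\<close>

lemma conditional_prob_distr:
  assumes M: "finite_measure M"
    and f: "f \<in> measurable M N"
    and G: "subalgebra M G" and H: "subalgebra N H"
    and fGH: "f \<in> measurable G H"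
    and pull: "\<And>A. A \<in> sets G \<Longrightarrow> \<exists>B\<in>sets H. A = f -` B \<inter> space M"
    and B: "B \<in> sets N"
  shows "AE \<omega> in M. conditional_prob M G (f -` B \<inter> space M) \<omega> =
    conditional_prob (distr M N f) H B (f \<omega>)"
proof -
  let ?D = "distr M N f"
  interpret M: finite_measure M by fact
  interpret D: finite_measure ?D by (rule M.finite_measure_distr[OF f])
  have HD: "subalgebra ?D H" using H by (simp add: subalgebra_def)
  interpret G: finite_measure_subalgebra M G by unfold_locales (rule G)
  interpret H: finite_measure_subalgebra ?D H by unfold_locales (rule HD)
  let ?g = "real_cond_exp ?D H (indicator B)"
  have iB: "integrable ?D (indicator B :: _ \<Rightarrow> real)"
    using B by (simp add: integrable_indicator_iff D.emeasure_finite less_top[symmetric])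
  have g_int: "integrable ?D ?g" by (rule H.real_cond_exp_int(1)[OF iB])
  have gN: "?g \<in> borel_measurable N" by simp
  have fB: "f -` B \<inter> space M \<in> sets M" by (rule measurable_sets[OF f B])
  have "AE \<omega> in M. real_cond_exp M G (indicator (f -` B \<inter> space M)) \<omega> = ?g (f \<omega>)"
  proof (rule G.real_cond_exp_charact)
    fix A assume A: "A \<in> sets G"
    then obtain C where C: "C \<in> sets H" and AC: "A = f -` C \<inter> space M" using pull by blast
    have CN: "C \<in> sets N" using C H by (auto simp: subalgebra_def)
    \<comment> \<open>With \<open>A\<close> written through \<open>C\<close>, the integrand depends
      on \<omega> only via \<open>f \<omega>\<close>, so \<open>integral_distr\<close>
      applies.\<close>
    have "(\<integral>\<omega>\<in>A. indicator (f -` B \<inter> space M) \<omega> \<partial>M) =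
        (\<integral>\<omega>. (indicator C (f \<omega>) * indicator B (f \<omega>) :: real) \<partial>M)"
      unfolding set_lebesgue_integral_def
      by (rule Bochner_Integration.integral_cong) (auto simp: AC indicator_def)
    also have "\<dots> = (\<integral>x\<in>C. indicator B x \<partial>?D)"
      unfolding set_lebesgue_integral_def using f CN B by (simp add: integral_distr)
    also have "\<dots> = (\<integral>x\<in>C. ?g x \<partial>?D)" by (rule H.real_cond_exp_intA[OF iB C])
    also have "\<dots> = (\<integral>\<omega>. indicator C (f \<omega>) * ?g (f \<omega>) \<partial>M)"
      unfolding set_lebesgue_integral_def using f CN gN by (simp add: integral_distr)
    also have "\<dots> = (\<integral>\<omega>\<in>A. ?g (f \<omega>) \<partial>M)"
      unfolding set_lebesgue_integral_def
      by (rule Bochner_Integration.integral_cong) (auto simp: AC indicator_def)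
    finally show "(\<integral>\<omega>\<in>A. indicator (f -` B \<inter> space M) \<omega> \<partial>M) = (\<integral>\<omega>\<in>A. ?g (f \<omega>) \<partial>M)" .
  next
    show "integrable M (indicator (f -` B \<inter> space M) :: _ \<Rightarrow> real)"
      using fB by (simp add: integrable_indicator_iff M.emeasure_finite less_top[symmetric])
    show "integrable M (\<lambda>\<omega>. ?g (f \<omega>))" by (rule integrable_distr[OF f g_int])
    show "(\<lambda>\<omega>. ?g (f \<omega>)) \<in> borel_measurable G"
      by (rule measurable_compose[OF fGH borel_measurable_cond_exp])
  qed
  then show ?thesis unfolding conditional_prob_def .
qed

text \<open>The events comparing \<open>Y \<circ> f\<close> with \<open>q \<circ> f\<close> are
  preimages of those comparing \<open>Y\<close> with \<open>q\<close>, so both quantile bounds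
  transfer by \<open>conditional_prob_distr\<close>.\<close>

lemma is_cond_quantile_distr:
  assumes M: "finite_measure M"
    and f: "f \<in> measurable M N"
    and G: "subalgebra M G" and H: "subalgebra N H"
    and fGH: "f \<in> measurable G H"
    and pull: "\<And>A. A \<in> sets G \<Longrightarrow> \<exists>B\<in>sets H. A = f -` B \<inter> space M"
    and Y[measurable]: "Y \<in> borel_measurable N"
    and q: "is_cond_quantile (distr M N f) H Y l q"
  shows "is_cond_quantile M G (\<lambda>\<omega>. Y (f \<omega>)) l (\<lambda>\<omega>. q (f \<omega>))"
proof -
  have qH: "q \<in> borel_measurable H" using q by (simp add: is_cond_quantile_def)
  then have qN[measurable]: "q \<in> borel_measurable N" by (rule measurable_from_subalg[OF H])
  have lift: "AE \<omega> in M. c \<le> conditional_prob M G {\<omega>' \<in> space M. f \<omega>' \<in> B} \<omega>"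
    if B: "B \<in> sets N" and c: "AE x in distr M N f. c \<le> conditional_prob (distr M N f) H B x"
    for B c
  proof -
    have "AE \<omega> in M. c \<le> conditional_prob (distr M N f) H B (f \<omega>)"
      by (rule AE_distrD[OF f c])
    moreover have "f -` B \<inter> space M = {\<omega>' \<in> space M. f \<omega>' \<in> B}" by auto
    ultimately show ?thesis
      using conditional_prob_distr[OF M f G H fGH pull B] by auto
  qed
  \<comment> \<open>The condition \<open>f \<omega> \<in> space N\<close> is automatic because
    \<open>f\<close> maps \<open>space M\<close> into \<open>space N\<close>.\<close>
  have eq: "{\<omega> \<in> space M. f \<omega> \<in> {x \<in> space N. P x}} = {\<omega> \<in> space M. P (f \<omega>)}" for P
    using measurable_space[OF f] by auto
  have "AE \<omega> in M. 1 - l \<le> conditional_prob M G {\<omega> \<in> space M. q (f \<omega>) \<le> Y (f \<omega>)} \<omega>"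
    using lift[of "{x \<in> space N. q x \<le> Y x}" "1 - l"] q
    unfolding eq by (simp add: is_cond_quantile_def)
  moreover have "AE \<omega> in M. l \<le> conditional_prob M G {\<omega> \<in> space M. Y (f \<omega>) \<le> q (f \<omega>)} \<omega>"
    using lift[of "{x \<in> space N. Y x \<le> q x}" l] q
    unfolding eq by (simp add: is_cond_quantile_def)
  ultimately show ?thesis
    using measurable_compose[OF fGH qH] by (simp add: is_cond_quantile_def)
qed

lemma cond_quantile_unique_distr:
  assumes M: "finite_measure M"
    and f: "f \<in> measurable M N"
    and G: "subalgebra M G" and H: "subalgebra N H"
    and fGH: "f \<in> measurable G H"
    and pull: "\<And>A. A \<in> sets G \<Longrightarrow> \<exists>B\<in>sets H. A = f -` B \<inter> space M"
    and Y: "Y \<in> borel_measurable N"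
    and unique: "cond_quantile_unique M G (\<lambda>\<omega>. Y (f \<omega>)) l"
  shows "cond_quantile_unique (distr M N f) H Y l"
  unfolding cond_quantile_unique_def
proof (intro allI impI)
  fix q q'
  assume q: "is_cond_quantile (distr M N f) H Y l q"
    and q': "is_cond_quantile (distr M N f) H Y l q'"
  have [measurable]: "q \<in> borel_measurable N" "q' \<in> borel_measurable N"
    using q q' by (auto simp: is_cond_quantile_def intro: measurable_from_subalg[OF H])
  have "AE \<omega> in M. q (f \<omega>) = q' (f \<omega>)"
    using unique is_cond_quantile_distr[OF M f G H fGH pull Y q]
      is_cond_quantile_distr[OF M f G H fGH pull Y q']
    unfolding cond_quantile_unique_def by blast
  \<comment> \<open>Passing from \<open>M\<close> to the law requires the set where \<open>q\<close>
    and \<open>q'\<close> agree to be measurable in \<open>N\<close>, hence the two measurability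
    facts above.\<close>
  then show "AE x in distr M N f. q x = q' x" by (subst AE_distr_iff[OF f]) auto
qed

lemma funpow_seq_shift: "(seq_shift ^^ i) x = (\<lambda>n. x (i + n))"
  by (induction i arbitrary: x) (simp_all add: seq_shift_def funpow_Suc_right del: funpow.simps)

text \<open>Dropping the first term of an orbit does not affect whether it visits \<open>B\<close>
  infinitely often. The invariance is thus exact, for an arbitrary Borel set
  \<open>B\<close>.\<close>

lemma limsup_shift_invariant:
  assumes "B \<in> sets borel"
  shows "{x. \<exists>\<^sub>\<infinity>i. (seq_shift ^^ i) x \<in> B} \<in> shift_invariant_sets"
proof -
  have [measurable]: "(seq_shift ^^ i) \<in> borel_measurable borel" for i
    using measurable_seq_shift by (rule measurable_compose_n)
  note assms[measurable]
  \<comment> \<open>\<open>INFM_nat\<close> turns "infinitely often" into countable quantifiers over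
    the naturals.\<close>
  have "{x \<in> space borel. \<exists>\<^sub>\<infinity>i. (seq_shift ^^ i) x \<in> B} \<in> sets borel"
    unfolding INFM_nat by measurable
  moreover have "(\<exists>\<^sub>\<infinity>i. (seq_shift ^^ i) (seq_shift x) \<in> B) \<longleftrightarrow> (\<exists>\<^sub>\<infinity>i. (seq_shift ^^ i) x \<in> B)" for x
  proof -
    have "(\<exists>\<^sub>\<infinity>i. (seq_shift ^^ Suc i) x \<in> B) \<longleftrightarrow> (\<exists>\<^sub>\<infinity>i. (seq_shift ^^ i) x \<in> B)"
      unfolding frequently_def
      using eventually_sequentially_Suc[of "\<lambda>i. (seq_shift ^^ i) x \<notin> B"]
      by (simp only: cofinite_eq_sequentially)
    then show ?thesis by (simp only: funpow_Suc_right comp_apply)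
  qed
  ultimately show ?thesis by (auto simp: shift_invariant_sets_def)
qed

text \<open>The set \<open>B\<close> witnessing invariance of \<open>A\<close> may fail to be
  shift-invariant away from the paths of \<open>X\<close>; replacing it by its limsup set repairs
  this without changing the preimage.\<close>

lemma invariant_event_pullback:
  assumes "A \<in> invariant_events M X"
  shows "\<exists>B\<in>shift_invariant_sets. A = (\<lambda>\<omega> n. X n \<omega>) -` B \<inter> space M"
proof -
  obtain B where B: "B \<in> sets borel"
    and A: "\<And>i. A = {\<omega> \<in> space M. (\<lambda>n. X (i + n) \<omega>) \<in> B}"
    using assms unfolding invariant_events_def by blast
  have "\<omega> \<in> A \<longleftrightarrow> (\<exists>\<^sub>\<infinity>i. (seq_shift ^^ i) (\<lambda>n. X n \<omega>) \<in> B)" if "\<omega> \<in> space M" for \<omega>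
  proof -
    have "(seq_shift ^^ i) (\<lambda>n. X n \<omega>) \<in> B \<longleftrightarrow> \<omega> \<in> A" for i
      using A[of i] that by (auto simp: funpow_seq_shift)
    \<comment> \<open>Along a fixed path, membership in \<open>B\<close> is the same for every
      \<open>i\<close>, so it holds infinitely often exactly when it holds at all.\<close>
    then show ?thesis by simp
  qed
  moreover have "A \<subseteq> space M" using A[of 0] by auto
  ultimately show ?thesis
    by (intro bexI[OF _ limsup_shift_invariant[OF B]]) auto
qed

lemma measurable_invariant_field:
  assumes "(\<lambda>\<omega> n. X n \<omega>) \<in> borel_measurable M"
  shows "(\<lambda>\<omega> n. X n \<omega>) \<in> measurable (invariant_field M X) shift_invariant_field"
proof (rule measurableI)
  fix B assume "B \<in> sets shift_invariant_field"
  then have B: "B \<in> sets borel" and "B = seq_shift -` B"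
    unfolding sets_shift_invariant_field shift_invariant_sets_def by blast+
  then have inv: "seq_shift x \<in> B \<longleftrightarrow> x \<in> B" for x
    by blast
  have "(seq_shift ^^ i) x \<in> B \<longleftrightarrow> x \<in> B" for i x
    by (induction i) (simp_all add: inv)
  then have "(\<lambda>n. X (i + n) \<omega>) \<in> B \<longleftrightarrow> (\<lambda>n. X n \<omega>) \<in> B" for i \<omega>
    unfolding funpow_seq_shift .
  then have "(\<lambda>\<omega> n. X n \<omega>) -` B \<inter> space M = {\<omega> \<in> space M. (\<lambda>n. X (i + n) \<omega>) \<in> B}" for i
    by auto
  with measurable_sets[OF assms B] B
  have "(\<lambda>\<omega> n. X n \<omega>) -` B \<inter> space M \<in> invariant_events M X"
    unfolding invariant_events_def by blast
  then show "(\<lambda>\<omega> n. X n \<omega>) -` B \<inter> space (invariant_field M X) \<in> sets (invariant_field M X)"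
    by (simp add: sets_invariant_field) (simp add: invariant_field_def space_measure_of_conv)
qed (simp add: shift_invariant_field_def space_measure_of_conv)

theorem theorem3p2:
  fixes M :: "'a measure" and X :: "nat \<Rightarrow> 'a \<Rightarrow> real" and l :: real
    and Q :: "(nat \<Rightarrow> real) measure" and Y :: "(nat \<Rightarrow> real) \<Rightarrow> real"
  assumes "prob_space M"
    and "\<And>n. X n \<in> borel_measurable M"
    and "strictly_stationary M X"
    and "0 < l" and "l < 1"
    and "Q = distr M borel (\<lambda>\<omega> n. X n \<omega>)"
    and "Y = (\<lambda>x. x 0)"
    and "cond_quantile_unique M (invariant_field M X) (X 0) l"
  shows "cond_quantile_unique Q shift_invariant_field Y l"
proof -
  have X: "(\<lambda>\<omega> n. X n \<omega>) \<in> borel_measurable M"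
    by (rule measurable_coordinatewise_then_product) (rule assms(2))
  show ?thesis
    unfolding assms(6)
  \<comment> \<open>Here \<open>f\<close> is the law map, with \<open>invariant_field M X\<close> as
    \<open>G\<close> and \<open>shift_invariant_field\<close> as \<open>H\<close>;
    \<open>invariant_event_pullback\<close> supplies \<open>pull\<close>.\<close>
  proof (rule cond_quantile_unique_distr[OF _ X subalgebra_invariant_field
        subalgebra_shift_invariant_field[OF refl] measurable_invariant_field[OF X]])
    show "finite_measure M" using assms(1) by (rule prob_space.finite_measure)
    show "Y \<in> borel_measurable borel" by (simp add: assms(7))
    show "cond_quantile_unique M (invariant_field M X) (\<lambda>\<omega>. Y (\<lambda>n. X n \<omega>)) l"
      using assms(8) by (simp add: assms(7))
  qed (simp add: sets_invariant_field sets_shift_invariant_field invariant_event_pullback)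
qed

end
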